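(* Let $\mathbb{K}\in\{\mathbb{R},\mathbb{C}\}$, let $\mathcal{A}$ be a unitary Banach algebra over $\mathbb{K}$, let $\{\alpha_n\}_{n\in\mathbb{N}}\subset\mathbb{K}$ be such that the radius of convergence of $g(\lambda)=\sum_{n=0}^\infty\alpha_n\lambda^n$ is $R>0$, and let $0<r<R$. Let $X$ be a Banach space over $\mathbb{K}$, $D\subseteq X$ an open set, and $\mathcal{T}:D\to\mathcal{A}$ a Fréchet differentiable mapping such that either $\mathcal{T}(D)\subseteq B_r(\mathbf{0})$, or alternatively $D$ is convex and bounded and $\sup_{x\in D}\|\mathcal{T}^{[1]}(x)\|_{B(X,\mathcal{A})}<\infty$. Set $\widetilde{r}=\sup_{x\in D}\|\mathcal{T}(x)\|_{\mathcal{A}}$. Then: (1) $\widetilde{r}<\infty$, and if $\widetilde{r}<R$ then $$g\circ\mathcal{T}=\sum_{n=0}^{\infty}\alpha_n\mathcal{T}^n,$$ where the series is uniformly convergent on $D$ and $\mathcal{T}^n:D\ni x\mapsto\mathcal{T}(x)^n$. (2) If $0<\widetilde{r}<R$, then $g\circ\mathcal{T}$ is Fréchet differentiable and for all $x\in D$ $$[g\circ\mathcal{T}]^{[1]}(x)=\sum_{n=0}^{\infty}\alpha_n\,u_n^{[1]}(\mathcal{T}(x))\,\mathcal{T}^{[1]}(x),\qquad( * )$$ where the series converges in $B(X,\mathcal{A})$. Moreover: (a) if $\mathcal{T}^{[1]}:D\to B(X,\mathcal{A})$ is continuous, then $[g\circ\mathcal{T}]^{[1]}:D\to B(X,\mathcal{A})$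 is also continuous; (b) if $\sup_{x\in D}\|\mathcal{T}^{[1]}(x)\|_{B(X,\mathcal{A})}<\infty$, then the series in $( * )$ converges absolutely uniformly on $D$.
   Context: A Banach algebra is an associative algebra over $\mathbb{K}$ with a complete norm satisfying $\|AB\|\le\|A\|\|B\|$; it is unitary if it has a unit $\mathbf{1}$, and then $\|\mathbf{1}\|=1$ is assumed. $\mathbb{N}=\{0,1,2,\dots\}$. $B_r(\mathbf{0})=\{T\in\mathcal{A}:\|T\|_{\mathcal{A}}<r\}$. $B(X,\mathcal{A})$ is the Banach space of bounded $\mathbb{K}$-linear maps $X\to\mathcal{A}$ with operator norm and $B(\mathcal{A})=B(\mathcal{A},\mathcal{A})$. The function $g$ is also regarded as the map $g:B_R(\mathbf{0})\to\mathcal{A}$, $g(T)=\sum_{n=0}^\infty\alpha_nT^n$. For a map $f:U\subseteq F\to G$ between Banach spaces ($U$ open), $f^{[1]}:U\to B(F,G)$ is its Fréchet differential function. $u_n:\mathcal{A}\to\mathcal{A}$ is $u_n(T)=T^n$, and $u_n^{[1]}:\mathcal{A}\to B(\mathcal{A})$ is its Fréchet differential function; juxtaposition $u_n^{[1]}(\mathcal{T}(x))\,\mathcal{T}^{[1]}(x)$ denotes composition of linear maps. A series $\sum_nf_n$ of maps from a set $S$ to a Banach space $Y$ converges absolutely uniformly on $S$ if $\sum_n\sup_{u\in S}\|f_n(u)\|_Y<\infty$. *)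

theory Defs
  imports "HOL-Analysis.Analysis"
begin

text \<open>
  The scalar field \<open>K\<close> is a type \<open>'k\<close> of sort
  \<open>{real_normed_field, banach}\<close>. The norm of such a field is multiplicative, so by
  Gelfand--Mazur it is, up to isometric isomorphism, \<open>real\<close> or \<open>complex\<close>, and both are instances.
  A Banach space over \<open>K\<close> is a type of class \<^class>\<open>banach\<close> together with a scalar
  multiplication by \<open>K\<close> that extends the built-in real one.
\<close>

locale banach_space_over = vector_space scale
  for scale :: "'k::{real_normed_field,banach} \<Rightarrow> 'v::banach \<Rightarrow> 'v" +
  assumes norm_scale: "norm (scale c x) = norm c * norm x"
    and scale_of_real: "scale (of_real t) x = t *\<^sub>R x"

text \<open>The class \<^class>\<open>real_normed_algebra_1\<close> provides submultiplicativity and \<open>norm 1 = 1\<close>.\<close>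

locale unital_banach_algebra_over = banach_space_over scale
  for scale :: "'k::{real_normed_field,banach} \<Rightarrow> 'a::{real_normed_algebra_1,banach} \<Rightarrow> 'a" +
  assumes scale_mult_left: "scale c x * y = scale c (x * y)"
    and scale_mult_right: "x * scale c y = scale c (x * y)"

lemma unital_banach_algebra_over_real:
  "unital_banach_algebra_over (scaleR :: real \<Rightarrow> 'a \<Rightarrow> 'a::{real_normed_algebra_1,banach})"
  by unfold_locales (auto simp: algebra_simps)

lemma unital_banach_algebra_over_complex:
  "unital_banach_algebra_over ((*) :: complex \<Rightarrow> complex \<Rightarrow> complex)"
  by unfold_locales (auto simp: algebra_simps norm_mult scaleR_conv_of_real)

text \<open>
  \<open>B(X, Y)\<close> is the subspace of \<open>K\<close>-linear elements of the type of bounded real-linear maps;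
  the norm of that type is the operator norm.
\<close>

definition bounded_linear_maps ::
    "('k \<Rightarrow> 'v \<Rightarrow> 'v) \<Rightarrow> ('k \<Rightarrow> 'w \<Rightarrow> 'w)
      \<Rightarrow> ('v::real_normed_vector \<Rightarrow>\<^sub>L 'w::real_normed_vector) set"
  where "bounded_linear_maps sX sY =
    {L. \<forall>c v. blinfun_apply L (sX c v) = sY c (blinfun_apply L v)}"

definition scale_blinfun ::
    "('k \<Rightarrow> 'w \<Rightarrow> 'w) \<Rightarrow> 'k
      \<Rightarrow> ('v::real_normed_vector \<Rightarrow>\<^sub>L 'w::real_normed_vector) \<Rightarrow> ('v \<Rightarrow>\<^sub>L 'w)"
  where "scale_blinfun sY c L = Blinfun (\<lambda>v. sY c (blinfun_apply L v))"

lemma (in banach_space_over) bounded_linear_scale: "bounded_linear (scale c)"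
proof (rule bounded_linear_intro)
  show "scale c (t *\<^sub>R x) = t *\<^sub>R scale c x" for t x
    by (metis scale_of_real scale_left_commute)
  show "norm (scale c x) \<le> norm x * norm c" for x
    by (simp add: norm_scale mult.commute)
qed (rule scale_right_distrib)

lemma (in banach_space_over) blinfun_apply_scale_blinfun:
  "blinfun_apply (scale_blinfun scale c L) v = scale c (blinfun_apply L v)"
  unfolding scale_blinfun_def
  by (subst bounded_linear_Blinfun_apply)
    (auto intro: bounded_linear_compose[OF bounded_linear_scale] blinfun.bounded_linear_right)

text \<open>
  Frechet differentiability over \<open>K\<close>: the first-order approximation is the one of
  \<^const>\<open>has_derivative\<close>, and the derivative has to lie in \<open>B(X, Y)\<close>.
\<close>

definition has_frechet_derivative ::
    "('k \<Rightarrow> 'v \<Rightarrow> 'v) \<Rightarrow> ('k \<Rightarrow> 'w \<Rightarrow> 'w)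
      \<Rightarrow> ('v::real_normed_vector \<Rightarrow> 'w::real_normed_vector) \<Rightarrow> ('v \<Rightarrow>\<^sub>L 'w) \<Rightarrow> 'v \<Rightarrow> bool"
  where "has_frechet_derivative sX sY f L x \<longleftrightarrow>
    L \<in> bounded_linear_maps sX sY \<and> (f has_derivative blinfun_apply L) (at x)"

text \<open>Only meant for open \<open>U\<close>, where \<^term>\<open>at x\<close> and \<^term>\<open>at x within U\<close> agree.\<close>

definition frechet_differentiable_on ::
    "('k \<Rightarrow> 'v \<Rightarrow> 'v) \<Rightarrow> ('k \<Rightarrow> 'w \<Rightarrow> 'w)
      \<Rightarrow> ('v::real_normed_vector \<Rightarrow> 'w::real_normed_vector) \<Rightarrow> 'v set \<Rightarrow> bool"
  where "frechet_differentiable_on sX sY f U \<longleftrightarrow>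
    (\<forall>x\<in>U. \<exists>L. has_frechet_derivative sX sY f L x)"

definition frechet_differential ::
    "('k \<Rightarrow> 'v \<Rightarrow> 'v) \<Rightarrow> ('k \<Rightarrow> 'w \<Rightarrow> 'w)
      \<Rightarrow> ('v::real_normed_vector \<Rightarrow> 'w::real_normed_vector) \<Rightarrow> 'v \<Rightarrow> ('v \<Rightarrow>\<^sub>L 'w)"
  where "frechet_differential sX sY f x = (THE L. has_frechet_derivative sX sY f L x)"

lemma frechet_differential_eqI:
  assumes "has_frechet_derivative sX sY f L x"
  shows "frechet_differential sX sY f x = L"
  unfolding frechet_differential_def
proof (rule the_equality)
  show "has_frechet_derivative sX sY f L x" by (fact assms)
next
  fix M assume "has_frechet_derivative sX sY f M x"
  then show "M = L"
    using assms has_derivative_unique unfolding has_frechet_derivative_def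
    by (metis blinfun_apply_inject)
qed

text \<open>The sum is meaningful for \<open>norm S\<close> less than the radius of convergence.\<close>

definition power_series_map ::
    "('k \<Rightarrow> 'a \<Rightarrow> 'a) \<Rightarrow> (nat \<Rightarrow> 'k) \<Rightarrow> 'a::real_normed_algebra_1 \<Rightarrow> 'a"
  where "power_series_map sA \<alpha> S = (\<Sum>n. sA (\<alpha> n) (S ^ n))"

text \<open>Suprema of norms are taken in \<open>[0, \<infinity>]\<close>; in particular the supremum over \<open>{}\<close> is \<open>0\<close>.\<close>

definition sup_norm_on :: "'s set \<Rightarrow> ('s \<Rightarrow> 'w::real_normed_vector) \<Rightarrow> ennreal"
  where "sup_norm_on S f = (SUP x\<in>S. ennreal (norm (f x)))"

definition abs_uniformly_convergent_on ::
    "'s set \<Rightarrow> (nat \<Rightarrow> 's \<Rightarrow> 'w::real_normed_vector) \<Rightarrow> bool"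
  where "abs_uniformly_convergent_on S f \<longleftrightarrow> (\<Sum>n. sup_norm_on S (f n)) < \<infinity>"

end

theory Submission imports Defs begin

text \<open>
  The power map \<open>S \<mapsto> S ^ n\<close> of a Banach algebra has the differential
  \<open>H \<mapsto> (\<Sum>i<n. S ^ i * H * S ^ (n - 1 - i))\<close>, whose norm is at most
  \<open>n * norm S ^ (n - 1)\<close>: without commutativity the directional increments cannot be collected
  into \<open>n * S ^ (n - 1) * H\<close>, but the classical bound survives
  (\<open>norm_power_differential_le\<close>). Hence, on a ball
  of radius \<open>\<rho>\<close> strictly below the radius of convergence, the power series and its termwise
  differential are dominated by the numerical series of \<open>norm (\<alpha> n) * \<rho> ^ n\<close> and of
  \<open>norm (\<alpha> n) * n * \<rho> ^ (n - 1)\<close>, both of which converge. The Weierstrass test makes both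
  series converge uniformly on that ball, so that the power series may be differentiated term by
  term there (\<open>power_series_map_has_derivative\<close>) and its differential is continuous.

  If the supremum of \<open>norm (T x)\<close> is below the radius of convergence, some such \<open>\<rho>\<close> lies
  strictly above that supremum, so \<open>T\<close> maps \<open>D\<close> into the ball; the chain rule then gives the
  differential of the composite, the termwise formula is post-composition with the bounded linear
  map \<open>L \<mapsto> L o\<^sub>L T' x\<close>, and the numerical bounds, multiplied by a bound for \<open>T'\<close>, give absolute
  uniform convergence. Finiteness of the supremum itself is trivial when \<open>T\<close> maps into a ball,
  and otherwise follows from the mean value inequality on the bounded convex set \<open>D\<close>
  (\<open>sup_norm_on_finite_if_bounded_derivative\<close>).
\<close>

section \<open>Suprema of norms\<close>

lemma sup_norm_on_leI:
  assumes "\<And>x. x \<in> S \<Longrightarrow> norm (f x) \<le> B"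
  shows "sup_norm_on S f \<le> ennreal B"
  unfolding sup_norm_on_def using assms by (intro SUP_least ennreal_leI)

lemma norm_le_enn2real_sup_norm_on:
  assumes "sup_norm_on S f < \<infinity>" and "x \<in> S"
  shows "norm (f x) \<le> enn2real (sup_norm_on S f)"
proof -
  have "ennreal (norm (f x)) \<le> sup_norm_on S f"
    unfolding sup_norm_on_def using assms(2) by (rule SUP_upper)
  then show ?thesis
    using assms(1) by (metis enn2real_ennreal enn2real_mono infinity_ennreal_def norm_ge_zero)
qed

lemma abs_uniformly_convergent_onI:
  assumes bound: "\<And>n x. x \<in> S \<Longrightarrow> norm (f n x) \<le> M n"
    and nonneg: "\<And>n. 0 \<le> M n" and "summable M"
  shows "abs_uniformly_convergent_on S f"
proof -
  have "(\<Sum>n. sup_norm_on S (f n)) \<le> (\<Sum>n. ennreal (M n))"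
    by (intro suminf_le sup_norm_on_leI bound) auto
  also have "\<dots> = ennreal (suminf M)"
    by (rule suminf_ennreal2) (use assms in auto)
  finally show ?thesis
    unfolding abs_uniformly_convergent_on_def by (rule le_less_trans) simp
qed

text \<open>
  Along the segment to a fixed point of \<open>D\<close> the values of \<open>T\<close> change by at most the bound for
  the derivative times the diameter of \<open>D\<close>.
\<close>

lemma sup_norm_on_finite_if_bounded_derivative:
  assumes "convex D" "bounded D"
    and deriv: "\<And>x. x \<in> D \<Longrightarrow> (T has_derivative blinfun_apply (T' x)) (at x)"
    and finite: "sup_norm_on D T' < \<infinity>"
  shows "sup_norm_on D T < \<infinity>"
proof (cases "D = {}")
  case True
  then show ?thesis by (simp add: sup_norm_on_def bot_ennreal)
next
  case False
  then obtain a where a: "a \<in> D" by blast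
  define C where "C = enn2real (sup_norm_on D T')"
  have C: "norm (T' x) \<le> C" if "x \<in> D" for x
    unfolding C_def using finite that by (rule norm_le_enn2real_sup_norm_on)
  have "0 \<le> C" unfolding C_def by simp
  obtain d where d: "\<And>x. x \<in> D \<Longrightarrow> dist a x \<le> d"
    using \<open>bounded D\<close> bounded_any_center by blast
  have "norm (T x) \<le> C * d + norm (T a)" if "x \<in> D" for x
  proof -
    have "norm (T x - T a) \<le> C * norm (x - a)"
    proof (rule differentiable_bound[OF \<open>convex D\<close> _ _ that a])
      show "(T has_derivative blinfun_apply (T' y)) (at y within D)" if "y \<in> D" for y
        using deriv[OF that] by (rule has_derivative_at_withinI)
      show "onorm (blinfun_apply (T' y)) \<le> C" if "y \<in> D" for y
        using C[OF that] by (simp add: norm_blinfun.rep_eq)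
    qed
    also have "\<dots> \<le> C * d"
      using d[OF that] \<open>0 \<le> C\<close> by (intro mult_left_mono) (simp_all add: dist_norm norm_minus_commute)
    finally show ?thesis
      using norm_triangle_ineq2[of "T x" "T a"] by linarith
  qed
  then have "sup_norm_on D T \<le> ennreal (C * d + norm (T a))"
    by (rule sup_norm_on_leI)
  then show ?thesis by (rule le_less_trans) simp
qed

section \<open>Numerical majorants\<close>

lemma summable_norm_power_below_conv_radius:
  fixes \<alpha> :: "nat \<Rightarrow> 'k::{banach,real_normed_div_algebra}"
  assumes "0 \<le> \<rho>" "ereal \<rho> < conv_radius \<alpha>"
  shows "summable (\<lambda>n. norm (\<alpha> n) * \<rho> ^ n)"
  using abs_summable_in_conv_radius[of "of_real \<rho>" \<alpha>] assms
  by (simp add: norm_mult norm_power)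

text \<open>
  The factor \<open>n\<close> is absorbed by passing to a radius \<open>\<sigma>\<close> strictly between \<open>\<rho>\<close> and the radius of
  convergence. The truncated exponent at \<open>n = 0\<close> is harmless, as that term is \<open>0\<close>.
\<close>

lemma summable_norm_deriv_below_conv_radius:
  fixes \<alpha> :: "nat \<Rightarrow> 'k::{banach,real_normed_div_algebra}"
  assumes "0 \<le> \<rho>" "ereal \<rho> < conv_radius \<alpha>"
  shows "summable (\<lambda>n. norm (\<alpha> n) * (real n * \<rho> ^ (n - 1)))"
proof -
  obtain \<sigma> where \<sigma>: "\<rho> < \<sigma>" "ereal \<sigma> < conv_radius \<alpha>"
    using ereal_dense2[OF assms(2)] by auto
  have "summable (\<lambda>n. diffs (\<lambda>n. norm (\<alpha> n)) n * \<rho> ^ n)"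
  proof (rule termdiff_converges[where K = \<sigma>])
    show "norm \<rho> < \<sigma>" using assms \<sigma> by simp
    fix x :: real assume "norm x < \<sigma>"
    then have "ereal \<bar>x\<bar> < conv_radius \<alpha>"
      using less_trans[of "ereal \<bar>x\<bar>" "ereal \<sigma>" "conv_radius \<alpha>"] \<sigma>(2) by simp
    then have "summable (\<lambda>n. norm (norm (\<alpha> n) * x ^ n))"
      using summable_norm_power_below_conv_radius[of "\<bar>x\<bar>" \<alpha>] by (simp add: abs_mult power_abs)
    then show "summable (\<lambda>n. norm (\<alpha> n) * x ^ n)"
      by (rule summable_norm_cancel)
  qed
  then have "summable (\<lambda>n. norm (\<alpha> (Suc n)) * (real (Suc n) * \<rho> ^ (Suc n - 1)))"
    by (simp add: diffs_def mult_ac)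
  then show ?thesis by (subst (asm) summable_Suc_iff)
qed

section \<open>The differential of the power map\<close>

text \<open>
  The recursion is the product rule for \<open>S * S ^ n\<close>; it unfolds to the map
  \<open>H \<mapsto> (\<Sum>i<n. S ^ i * H * S ^ (n - 1 - i))\<close>.
\<close>

primrec power_differential :: "nat \<Rightarrow> 'a::real_normed_algebra_1 \<Rightarrow> 'a \<Rightarrow>\<^sub>L 'a" where
  "power_differential 0 S = 0"
| "power_differential (Suc n) S =
     (blinfun_mult_right S o\<^sub>L power_differential n S) + blinfun_mult_left (S ^ n)"

lemma has_derivative_power_map:
  "((\<lambda>S. S ^ n) has_derivative blinfun_apply (power_differential n S)) (at S)"
proof (induction n)
  case 0
  then show ?case by (simp add: zero_blinfun.rep_eq)
next
  case (Suc n)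
  have "((\<lambda>S. S * S ^ n) has_derivative
      (\<lambda>H. S * blinfun_apply (power_differential n S) H + H * S ^ n)) (at S)"
    by (intro has_derivative_mult has_derivative_ident Suc.IH)
  then show ?case
    by (simp add: plus_blinfun.rep_eq)
qed

lemma norm_power_differential_le:
  "norm (power_differential n S) \<le> real n * norm S ^ (n - 1)"
proof (induction n)
  case 0
  then show ?case by simp
next
  case (Suc n)
  have mult_right: "norm (blinfun_mult_right S) \<le> norm S" for S :: 'a
    by (rule norm_blinfun_bound) (auto simp: norm_mult_ineq)
  have mult_left: "norm (blinfun_mult_left S) \<le> norm S" for S :: 'a
    by (rule norm_blinfun_bound) (auto simp: norm_mult_ineq mult.commute[of "norm S"])
  have "norm (power_differential (Suc n) S)
      \<le> norm (blinfun_mult_right S) * norm (power_differential n S) + norm (blinfun_mult_left (S ^ n))"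
    by (auto intro!: order_trans[OF norm_triangle_ineq] norm_blinfun_compose)
  also have "\<dots> \<le> norm S * (real n * norm S ^ (n - 1)) + norm S ^ n"
    by (intro add_mono mult_mono mult_right Suc.IH order_trans[OF mult_left norm_power_ineq]) auto
  also have "\<dots> = real (Suc n) * norm S ^ (Suc n - 1)"
    by (cases n) (auto simp: algebra_simps)
  finally show ?case .
qed

lemma continuous_on_power_differential: "continuous_on A (power_differential n)"
proof (induction n)
  case 0
  then show ?case by simp
next
  case (Suc n)
  then show ?case
    by (auto intro!: continuous_intros
        bounded_bilinear.continuous_on[OF bounded_bilinear_blinfun_compose]
        bounded_linear.continuous_on[OF bounded_linear_blinfun_mult_right]
        bounded_linear.continuous_on[OF bounded_linear_blinfun_mult_left])
qed

section \<open>Linearity over the scalar field\<close>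

lemma blinfun_compose_in_bounded_linear_maps:
  assumes "A \<in> bounded_linear_maps sY sZ" "B \<in> bounded_linear_maps sX sY"
  shows "A o\<^sub>L B \<in> bounded_linear_maps sX sZ"
  using assms by (simp add: bounded_linear_maps_def)

lemma has_frechet_derivative_frechet_differential:
  assumes "frechet_differentiable_on sX sY f U" "x \<in> U"
  shows "has_frechet_derivative sX sY f (frechet_differential sX sY f x) x"
  using assms unfolding frechet_differentiable_on_def by (metis frechet_differential_eqI)

context banach_space_over
begin

lemma scale_blinfun_in_bounded_linear_maps:
  assumes "L \<in> bounded_linear_maps sX scale"
  shows "scale_blinfun scale c L \<in> bounded_linear_maps sX scale"
  using assms unfolding bounded_linear_maps_def
  by (auto simp: blinfun_apply_scale_blinfun scale_left_commute)

lemma norm_scale_blinfun_le: "norm (scale_blinfun scale c L) \<le> norm c * norm L"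
  by (rule norm_blinfun_bound)
    (auto simp: blinfun_apply_scale_blinfun norm_scale mult.assoc
      intro!: mult_left_mono norm_blinfun)

lemma bounded_linear_scale_blinfun: "bounded_linear (scale_blinfun scale c)"
proof (rule bounded_linear_intro)
  show "norm (scale_blinfun scale c L) \<le> norm L * norm c" for L
    using norm_scale_blinfun_le by (simp add: mult.commute)
qed (auto intro!: blinfun_eqI
    simp: blinfun_apply_scale_blinfun blinfun.add_left blinfun.scaleR_left scale_right_distrib
      bounded_linear.linear[OF bounded_linear_scale, THEN linear_scale])

lemma scale_blinfun_compose:
  "scale_blinfun scale c (A o\<^sub>L B) = scale_blinfun scale c A o\<^sub>L B"
  by (rule blinfun_eqI) (simp add: blinfun_apply_scale_blinfun)

text \<open>
  \<open>K\<close>-linearity is a family of equations between evaluations, and these are continuous in the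
  operator norm.
\<close>

lemma bounded_linear_maps_sums:
  assumes F: "\<And>n. F n \<in> bounded_linear_maps sX scale" and sums: "F sums L"
  shows "L \<in> bounded_linear_maps sX scale"
proof -
  have apply_sums: "(\<lambda>n. blinfun_apply (F n) v) sums blinfun_apply L v" for v
    using blinfun.bounded_linear_left sums by (rule bounded_linear.sums)
  have "blinfun_apply L (sX c v) = scale c (blinfun_apply L v)" for c v
  proof (rule sums_unique2)
    show "(\<lambda>n. blinfun_apply (F n) (sX c v)) sums blinfun_apply L (sX c v)"
      by (rule apply_sums)
    show "(\<lambda>n. blinfun_apply (F n) (sX c v)) sums scale c (blinfun_apply L v)"
      using F bounded_linear.sums[OF bounded_linear_scale apply_sums[of v], of c]
      by (simp add: bounded_linear_maps_def)
  qed
  then show ?thesis by (simp add: bounded_linear_maps_def)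
qed

end

section \<open>Power series in a Banach algebra\<close>

context unital_banach_algebra_over
begin

lemma power_differential_in_bounded_linear_maps:
  "power_differential n S \<in> bounded_linear_maps scale scale"
  unfolding bounded_linear_maps_def
  by (induction n)
    (auto simp: blinfun.add_left scale_mult_left scale_mult_right scale_right_distrib)

lemma frechet_differential_power_map:
  "frechet_differential scale scale (\<lambda>S. S ^ n) = power_differential n"
  by (rule ext, rule frechet_differential_eqI)
    (simp add: has_frechet_derivative_def has_derivative_power_map
      power_differential_in_bounded_linear_maps)

definition power_series_differential :: "(nat \<Rightarrow> 'k) \<Rightarrow> 'a \<Rightarrow> 'a \<Rightarrow>\<^sub>L 'a" where
  "power_series_differential \<alpha> S = (\<Sum>n. scale_blinfun scale (\<alpha> n) (power_differential n S))"

lemma norm_scale_power_le: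
  assumes "norm S \<le> \<rho>"
  shows "norm (scale (\<alpha> n) (S ^ n)) \<le> norm (\<alpha> n) * \<rho> ^ n"
  unfolding norm_scale
  by (intro mult_left_mono order_trans[OF norm_power_ineq] power_mono assms) auto

lemma norm_scale_power_differential_le:
  assumes "norm S \<le> \<rho>"
  shows "norm (scale_blinfun scale (\<alpha> n) (power_differential n S))
    \<le> norm (\<alpha> n) * (real n * \<rho> ^ (n - 1))"
  by (intro order_trans[OF norm_scale_blinfun_le] mult_left_mono
      order_trans[OF norm_power_differential_le] power_mono assms) auto

context
  fixes \<alpha> :: "nat \<Rightarrow> 'k" and \<rho> :: real
  assumes \<rho>: "0 \<le> \<rho>" "ereal \<rho> < conv_radius \<alpha>"
begin

lemma power_series_map_uniform_limit:
  "uniform_limit (cball 0 \<rho>) (\<lambda>N S. \<Sum>n<N. scale (\<alpha> n) (S ^ n)) (power_series_map scale \<alpha>)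
     sequentially"
  unfolding power_series_map_def[abs_def]
  by (rule Weierstrass_m_test[OF _ summable_norm_power_below_conv_radius[OF \<rho>]])
    (simp add: norm_scale_power_le)

lemma power_series_differential_uniform_limit:
  "uniform_limit (cball 0 \<rho>)
     (\<lambda>N S. \<Sum>n<N. scale_blinfun scale (\<alpha> n) (power_differential n S))
     (power_series_differential \<alpha>) sequentially"
  unfolding power_series_differential_def[abs_def]
  by (rule Weierstrass_m_test[OF _ summable_norm_deriv_below_conv_radius[OF \<rho>]])
    (rule norm_scale_power_differential_le, simp)

lemma power_series_differential_sums:
  assumes "norm S \<le> \<rho>"
  shows "(\<lambda>n. scale_blinfun scale (\<alpha> n) (power_differential n S)) sums power_series_differential \<alpha> S"
  unfolding sums_def
  using tendsto_uniform_limitI[OF power_series_differential_uniform_limit] assms by simp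

lemma continuous_on_power_series_differential:
  "continuous_on (cball 0 \<rho>) (power_series_differential \<alpha>)"
proof (rule uniform_limit_theorem[OF _ power_series_differential_uniform_limit])
  show "\<forall>\<^sub>F N in sequentially. continuous_on (cball 0 \<rho>)
      (\<lambda>S. \<Sum>n<N. scale_blinfun scale (\<alpha> n) (power_differential n S))"
    by (intro always_eventually allI continuous_on_sum continuous_on_power_differential
        bounded_linear.continuous_on[OF bounded_linear_scale_blinfun])
qed simp

lemma power_series_differential_in_bounded_linear_maps:
  assumes "norm S \<le> \<rho>"
  shows "power_series_differential \<alpha> S \<in> bounded_linear_maps scale scale"
  by (rule bounded_linear_maps_sums[OF _ power_series_differential_sums[OF assms]])
    (intro scale_blinfun_in_bounded_linear_maps power_differential_in_bounded_linear_maps)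

text \<open>
  Uniform convergence of the differentials in operator norm, on a convex set, allows the series
  to be differentiated term by term; as \<open>S\<close> is interior to the ball, the derivative within the
  ball is a full derivative.
\<close>

lemma power_series_map_has_derivative:
  assumes S: "norm S < \<rho>"
  shows "(power_series_map scale \<alpha> has_derivative
    blinfun_apply (power_series_differential \<alpha> S)) (at S)"
proof -
  let ?F = "\<lambda>n S. scale_blinfun scale (\<alpha> n) (power_differential n S)"
  have S_ball: "S \<in> ball 0 \<rho>" using S by simp
  have sums: "(\<lambda>n. scale (\<alpha> n) (U ^ n)) sums power_series_map scale \<alpha> U" if "norm U < \<rho>" for U
    unfolding sums_def
    using tendsto_uniform_limitI[OF power_series_map_uniform_limit, of U] that by simp
  have "\<exists>g. \<forall>U\<in>ball 0 \<rho>. (\<lambda>n. scale (\<alpha> n) (U ^ n)) sums g U \<and>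
      (g has_derivative blinfun_apply (power_series_differential \<alpha> U)) (at U within ball 0 \<rho>)"
  proof (rule has_derivative_series)
    show "((\<lambda>U. scale (\<alpha> n) (U ^ n)) has_derivative blinfun_apply (?F n U)) (at U within ball 0 \<rho>)"
      for n U
      using bounded_linear.has_derivative[OF bounded_linear_scale
          has_derivative_at_withinI[OF has_derivative_power_map[of n U]]]
      by (simp add: blinfun_apply_scale_blinfun[abs_def])
    fix e :: real assume "0 < e"
    then have "\<forall>\<^sub>F N in sequentially. \<forall>U\<in>cball 0 \<rho>.
        dist (\<Sum>n<N. ?F n U) (power_series_differential \<alpha> U) < e"
      by (rule uniform_limitD[OF power_series_differential_uniform_limit])
    then show "\<forall>\<^sub>F N in sequentially. \<forall>U\<in>ball 0 \<rho>. \<forall>H.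
        norm ((\<Sum>n<N. blinfun_apply (?F n U) H) - blinfun_apply (power_series_differential \<alpha> U) H)
          \<le> e * norm H"
    proof eventually_elim
      case (elim N)
      show ?case
      proof (intro ballI allI)
        fix U H :: 'a assume "U \<in> ball 0 \<rho>"
        let ?E = "(\<Sum>n<N. ?F n U) - power_series_differential \<alpha> U"
        have "norm ?E \<le> e"
          using elim[rule_format, of U] \<open>U \<in> ball 0 \<rho>\<close> by (simp add: dist_norm)
        then have "norm (blinfun_apply ?E H) \<le> e * norm H"
          by (meson mult_right_mono norm_blinfun norm_ge_zero order_trans)
        then show "norm ((\<Sum>n<N. blinfun_apply (?F n U) H)
            - blinfun_apply (power_series_differential \<alpha> U) H) \<le> e * norm H"
          by (simp add: blinfun.diff_left blinfun.sum_left)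
      qed
    qed
  next
    show "S \<in> ball 0 \<rho>" by (rule S_ball)
    show "(\<lambda>n. scale (\<alpha> n) (S ^ n)) sums power_series_map scale \<alpha> S" using S by (rule sums)
  qed simp
  then obtain g where g: "\<forall>U\<in>ball 0 \<rho>. (\<lambda>n. scale (\<alpha> n) (U ^ n)) sums g U \<and>
      (g has_derivative blinfun_apply (power_series_differential \<alpha> U)) (at U within ball 0 \<rho>)"
    by blast
  have "(g has_derivative blinfun_apply (power_series_differential \<alpha> S)) (at S)"
    using conjunct2[OF bspec[OF g S_ball]] unfolding at_within_open[OF S_ball open_ball] .
  then show ?thesis
  proof (rule has_derivative_transform_within_open)
    show "g U = power_series_map scale \<alpha> U" if "U \<in> ball 0 \<rho>" for U
      by (rule sums_unique2[OF conjunct1[OF bspec[OF g that]] sums]) (use that in simp)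
  qed (use S_ball in simp_all)
qed

lemma power_series_map_has_frechet_derivative_compose:
  assumes T: "has_frechet_derivative sX scale T T' x" and "norm (T x) < \<rho>"
  shows "has_frechet_derivative sX scale (power_series_map scale \<alpha> \<circ> T)
    (power_series_differential \<alpha> (T x) o\<^sub>L T') x"
proof -
  have "(power_series_map scale \<alpha> \<circ> T has_derivative
      blinfun_apply (power_series_differential \<alpha> (T x)) \<circ> blinfun_apply T') (at x)"
    using T power_series_map_has_derivative[OF assms(2)]
    unfolding has_frechet_derivative_def by (intro diff_chain_at) auto
  moreover have "power_series_differential \<alpha> (T x) o\<^sub>L T' \<in> bounded_linear_maps sX scale"
    using T power_series_differential_in_bounded_linear_maps[of "T x"] assms(2)
    unfolding has_frechet_derivative_def
    by (intro blinfun_compose_in_bounded_linear_maps) auto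
  ultimately show ?thesis
    by (simp add: has_frechet_derivative_def blinfun_compose.rep_eq)
qed

end

end

section \<open>Power series of a differentiable map\<close>

theorem corollary2p16:
  fixes sA :: "'k::{real_normed_field,banach} \<Rightarrow> 'a::{real_normed_algebra_1,banach} \<Rightarrow> 'a"
    and sX :: "'k \<Rightarrow> 'x::banach \<Rightarrow> 'x"
    and \<alpha> :: "nat \<Rightarrow> 'k"
    and R :: ereal
    and r :: real
    and D :: "'x set"
    and T :: "'x \<Rightarrow> 'a"
    and rt :: ennreal
  assumes "unital_banach_algebra_over sA"
    and "banach_space_over sX"
    and "R = conv_radius \<alpha>" and "0 < R"
    and "0 < r" and "ereal r < R"
    and "open D"
    and "frechet_differentiable_on sX sA T D"
    and "T ` D \<subseteq> ball 0 r \<or>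
         (convex D \<and> bounded D \<and> sup_norm_on D (frechet_differential sX sA T) < \<infinity>)"
    and "rt = sup_norm_on D T"
  shows "rt < \<infinity> \<and>
    (enn2ereal rt < R \<longrightarrow>
      uniform_limit D (\<lambda>N x. \<Sum>n<N. sA (\<alpha> n) (T x ^ n)) (power_series_map sA \<alpha> \<circ> T) sequentially) \<and>
    (0 < rt \<and> enn2ereal rt < R \<longrightarrow>
      frechet_differentiable_on sX sA (power_series_map sA \<alpha> \<circ> T) D \<and>
      (\<forall>x\<in>D. (\<lambda>n. scale_blinfun sA (\<alpha> n)
                 (frechet_differential sA sA (\<lambda>S. S ^ n) (T x) o\<^sub>L frechet_differential sX sA T x))
             sums frechet_differential sX sA (power_series_map sA \<alpha> \<circ> T) x) \<and>
      (continuous_on D (frechet_differential sX sA T) \<longrightarrow>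
         continuous_on D (frechet_differential sX sA (power_series_map sA \<alpha> \<circ> T))) \<and>
      (sup_norm_on D (frechet_differential sX sA T) < \<infinity> \<longrightarrow>
         abs_uniformly_convergent_on D (\<lambda>n x. scale_blinfun sA (\<alpha> n)
           (frechet_differential sA sA (\<lambda>S. S ^ n) (T x) o\<^sub>L frechet_differential sX sA T x))))"
proof -
  interpret A: unital_banach_algebra_over sA by fact
  let ?T' = "frechet_differential sX sA T"
  let ?g = "power_series_map sA \<alpha>"
  let ?g' = "A.power_series_differential \<alpha>"
  let ?term = "\<lambda>n x. scale_blinfun sA (\<alpha> n)
    (frechet_differential sA sA (\<lambda>S. S ^ n) (T x) o\<^sub>L ?T' x)"
  have T': "has_frechet_derivative sX sA T (?T' x) x" if "x \<in> D" for x
    using assms(8) that by (rule has_frechet_derivative_frechet_differential)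

  have finite: "sup_norm_on D T < \<infinity>"
    using assms(9)
  proof
    assume "T ` D \<subseteq> ball 0 r"
    then have "sup_norm_on D T \<le> ennreal r"
      by (intro sup_norm_on_leI) (auto simp: subset_iff intro: less_imp_le)
    then show ?thesis by (rule le_less_trans) simp
  next
    assume "convex D \<and> bounded D \<and> sup_norm_on D ?T' < \<infinity>"
    then show ?thesis
      using T' by (intro sup_norm_on_finite_if_bounded_derivative[of D T ?T'])
        (auto simp: has_frechet_derivative_def)
  qed

  have main: "uniform_limit D (\<lambda>N x. \<Sum>n<N. sA (\<alpha> n) (T x ^ n)) (?g \<circ> T) sequentially"
    "frechet_differentiable_on sX sA (?g \<circ> T) D"
    "\<forall>x\<in>D. (\<lambda>n. ?term n x) sums frechet_differential sX sA (?g \<circ> T) x"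
    "continuous_on D ?T' \<Longrightarrow> continuous_on D (frechet_differential sX sA (?g \<circ> T))"
    "sup_norm_on D ?T' < \<infinity> \<Longrightarrow> abs_uniformly_convergent_on D ?term"
    if less: "enn2ereal rt < R"
  proof -
    define b where "b = enn2real rt"
    have "rt = ennreal b"
      using finite assms(10) by (simp add: b_def)
    then have "ereal b < conv_radius \<alpha>"
      using less assms(3) enn2ereal_ennreal[of b] by (simp add: b_def)
    \<comment> \<open>The gap between the supremum and the radius of convergence leaves room for an open ball.\<close>
    then obtain \<rho> where "b < \<rho>" and \<rho>: "ereal \<rho> < conv_radius \<alpha>"
      using ereal_dense2[of "ereal b" "conv_radius \<alpha>"] by auto
    have T_less: "norm (T x) < \<rho>" if "x \<in> D" for x
      using norm_le_enn2real_sup_norm_on[OF finite that] \<open>b < \<rho>\<close> assms(10) by (simp add: b_def)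
    have "0 \<le> b" by (simp add: b_def)
    then have "0 \<le> \<rho>" using \<open>b < \<rho>\<close> by simp
    have image: "T ` D \<subseteq> cball 0 \<rho>"
      using less_imp_le[OF T_less] by auto
    have compose: "has_frechet_derivative sX sA (?g \<circ> T) (?g' (T x) o\<^sub>L ?T' x) x" if "x \<in> D" for x
      using \<open>0 \<le> \<rho>\<close> \<rho> T'[OF that] T_less[OF that]
      by (rule A.power_series_map_has_frechet_derivative_compose)
    then have differential: "frechet_differential sX sA (?g \<circ> T) x = ?g' (T x) o\<^sub>L ?T' x"
      if "x \<in> D" for x
      using that by (intro frechet_differential_eqI)
    have term_eq: "?term n x = scale_blinfun sA (\<alpha> n) (power_differential n (T x)) o\<^sub>L ?T' x" for n x
      by (simp add: A.scale_blinfun_compose A.frechet_differential_power_map)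

    show "uniform_limit D (\<lambda>N x. \<Sum>n<N. sA (\<alpha> n) (T x ^ n)) (?g \<circ> T) sequentially"
      using uniform_limit_compose'[OF A.power_series_map_uniform_limit[OF \<open>0 \<le> \<rho>\<close> \<rho>], of T D] image
      by (simp add: image_subset_iff_funcset comp_def)
    show "frechet_differentiable_on sX sA (?g \<circ> T) D"
      unfolding frechet_differentiable_on_def using compose by blast
    show "\<forall>x\<in>D. (\<lambda>n. ?term n x) sums frechet_differential sX sA (?g \<circ> T) x"
    proof
      fix x assume x: "x \<in> D"
      show "(\<lambda>n. ?term n x) sums frechet_differential sX sA (?g \<circ> T) x"
        unfolding term_eq differential[OF x]
        using less_imp_le[OF T_less[OF x]]
        by (rule bounded_linear.sums
            [OF bounded_bilinear.bounded_linear_left[OF bounded_bilinear_blinfun_compose]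
              A.power_series_differential_sums[OF \<open>0 \<le> \<rho>\<close> \<rho>]])
    qed
    show "continuous_on D (frechet_differential sX sA (?g \<circ> T))" if "continuous_on D ?T'"
    proof -
      have "continuous_on D T"
        using T' unfolding has_frechet_derivative_def
        by (meson continuous_at_imp_continuous_on has_derivative_continuous)
      then have "continuous_on D (\<lambda>x. ?g' (T x))"
        by (rule continuous_on_compose2
            [OF A.continuous_on_power_series_differential[OF \<open>0 \<le> \<rho>\<close> \<rho>]]) (rule image)
      then have "continuous_on D (\<lambda>x. ?g' (T x) o\<^sub>L ?T' x)"
        using that by (rule bounded_bilinear.continuous_on[OF bounded_bilinear_blinfun_compose])
      then show ?thesis
        by (simp add: differential cong: continuous_on_cong)
    qed
    show "abs_uniformly_convergent_on D ?term" if C: "sup_norm_on D ?T' < \<infinity>"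
    proof (rule abs_uniformly_convergent_onI)
      fix n
      let ?C = "enn2real (sup_norm_on D ?T')"
      let ?M = "norm (\<alpha> n) * (real n * \<rho> ^ (n - 1))"
      show "0 \<le> ?M * ?C" using \<open>0 \<le> \<rho>\<close> by simp
      show "norm (?term n x) \<le> ?M * ?C" if x: "x \<in> D" for x
        unfolding term_eq
        using A.norm_scale_power_differential_le[of "T x" \<rho> \<alpha> n] T_less[OF x] \<open>0 \<le> \<rho>\<close>
          norm_le_enn2real_sup_norm_on[OF C x]
        by (intro order_trans[OF norm_blinfun_compose] mult_mono) auto
    next
      show "summable (\<lambda>n. norm (\<alpha> n) * (real n * \<rho> ^ (n - 1)) * enn2real (sup_norm_on D ?T'))"
        using summable_norm_deriv_below_conv_radius[OF \<open>0 \<le> \<rho>\<close> \<rho>] by (rule summable_mult2)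
    qed
  qed
  have "rt < \<infinity>" using finite assms(10) by simp
  then show ?thesis by (intro conjI impI main) simp_all
qed

end
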